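(* Let $F=\alpha^2/\beta$ be a (conic) Kropina metric on a manifold $M$ with navigation data $(h,W)$, i.e. $F=\frac{h^2}{2W_0}$ on $A=\bigcup_x A_x$. Let $V$ be a vector field on $M$ with $-V_x\in A_x$ and $F(x,-V_x)\le 1$, and let $\widetilde F$ be the solution of the navigation problem with navigation data $(F,V)$, i.e. $$F\Big(x,\frac{y}{\widetilde F(x,y)}-V_x\Big)=1.$$ Then: (1) If $F(x,-V_x)<1$ (for all $x\in M$), then $\widetilde F$ is a Randers metric. (2) If $F(x,-V_x)=1$ (for all $x\in M$), then $\widetilde F$ is a Kropina metric.
   Context: Randers metric: $\alpha+\beta$ with $\alpha=\sqrt{a_{ij}(x)y^iy^j}$ a Riemannian metric and $\beta=b_i(x)y^i$ a 1-form with $\|\beta_x\|_\alpha<1$. Kropina metric: $F=\alpha^2/\beta$ with $\alpha=\sqrt{a_{ij}(x)y^iy^j}$ a Riemannian metric and $\beta=b_i(x)y^i$ a nowhere zero 1-form, regarded as a conic Finsler metric, i.e. defined only on $A=\bigcup_{x\in M} A_x$, $A_x=\{y\in T_xM: \beta(y)>0\}$. Its navigation data $(h,W)$ are the Riemannian metric $h_{ij}=\frac{4}{b^2}a_{ij}$ and the vector field $W^i=\frac12 b^i$, where $b=\|\beta\|_\alpha$ and $b^i=a^{ij}b_j$. Then $\|W\|_h=1$, $F=\frac{h^2}{2W_0}$ with $h=h(x,y)=\sqrt{h_{ij}(x)y^iy^j}$ and $W_0=h_{ij}W^iy^j$, and $A_x=\{y: h(y,W_x)>0\}$ (with $h(\cdot,\cdot)$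 the inner product). Navigation problem: $\widetilde F(x,y)$ is the positive number satisfying $F(x,\frac{y}{\widetilde F(x,y)}-V_x)=1$. Since $F$ is only defined on $A$, the equation is understood for those $y$ for which there is such a number with $\frac{y}{\widetilde F(x,y)}-V_x\in A_x$; the conclusion means that $\widetilde F$ coincides there with (and is identified with) a Randers metric, respectively a conic Kropina metric. *)

theory Defs
  imports "HOL-Analysis.Analysis"
begin

section \<open>Smooth manifolds\<close>

text \<open>Only used for open \<open>S\<close>: \<open>f\<close> is \<open>k\<close> times continuously differentiable on \<open>S\<close>.\<close>

fun Ck_on :: "nat \<Rightarrow> 'e::euclidean_space set \<Rightarrow> ('e \<Rightarrow> 'f::real_normed_vector) \<Rightarrow> bool" where
  "Ck_on 0 S f \<longleftrightarrow> continuous_on S f"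
| "Ck_on (Suc k) S f \<longleftrightarrow>
     (\<forall>x\<in>S. f differentiable (at x)) \<and> (\<forall>v. Ck_on k S (\<lambda>x. frechet_derivative f (at x) v))"

definition smooth_on :: "'e::euclidean_space set \<Rightarrow> ('e \<Rightarrow> 'f::real_normed_vector) \<Rightarrow> bool" where
  "smooth_on S f \<longleftrightarrow> (\<forall>k. Ck_on k S f)"

text \<open>A chart is a pair of a domain and a coordinate map, the latter being relevant on the domain
  only.\<close>

type_synonym ('a, 'e) chart = "'a set \<times> ('a \<Rightarrow> 'e)"

definition chart_inv :: "('a, 'e) chart \<Rightarrow> 'e \<Rightarrow> 'a" where
  "chart_inv c = the_inv_into (fst c) (snd c)"

definition transition :: "('a, 'e) chart \<Rightarrow> ('a, 'e) chart \<Rightarrow> 'e \<Rightarrow> 'e" where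
  "transition c d = snd d \<circ> chart_inv c"

definition smooth_manifold :: "'a topology \<Rightarrow> ('a, 'e::euclidean_space) chart set \<Rightarrow> bool" where
  "smooth_manifold X \<A> \<longleftrightarrow>
     Hausdorff_space X \<and> second_countable X \<and>
     (\<Union>c\<in>\<A>. fst c) = topspace X \<and>
     (\<forall>c\<in>\<A>. openin X (fst c) \<and> open (snd c ` fst c) \<and>
        homeomorphic_map (subtopology X (fst c)) (top_of_set (snd c ` fst c)) (snd c)) \<and>
     (\<forall>c\<in>\<A>. \<forall>d\<in>\<A>. smooth_on (snd c ` (fst c \<inter> fst d)) (transition c d))"

section \<open>Tangent vectors\<close>

text \<open>A tangent vector at \<open>p\<close> is the family of its components in all charts around \<open>p\<close>, which
  transform by the derivatives of the transition maps. The components in all other charts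
  are set to 0, so that two tangent vectors at \<open>p\<close> are equal iff their components in one
  chart around \<open>p\<close> are. The type \<open>tvec\<close> contains all families of components; the tangent
  spaces are linear subspaces of it.\<close>

typedef ('a, 'e) tvec = "UNIV :: (('a, 'e) chart \<Rightarrow> 'e) set"
  morphisms comp_in Tvec by simp

setup_lifting type_definition_tvec

instantiation tvec :: (type, real_vector) real_vector
begin

lift_definition zero_tvec :: "('a, 'b) tvec" is "\<lambda>c. 0" .
lift_definition plus_tvec :: "('a, 'b) tvec \<Rightarrow> ('a, 'b) tvec \<Rightarrow> ('a, 'b) tvec"
  is "\<lambda>v w c. v c + w c" .
lift_definition minus_tvec :: "('a, 'b) tvec \<Rightarrow> ('a, 'b) tvec \<Rightarrow> ('a, 'b) tvec"
  is "\<lambda>v w c. v c - w c" .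
lift_definition uminus_tvec :: "('a, 'b) tvec \<Rightarrow> ('a, 'b) tvec"
  is "\<lambda>v c. - v c" .
lift_definition scaleR_tvec :: "real \<Rightarrow> ('a, 'b) tvec \<Rightarrow> ('a, 'b) tvec"
  is "\<lambda>r v c. r *\<^sub>R v c" .

instance
  by standard (transfer; simp add: fun_eq_iff algebra_simps)+

end

definition tangent_space ::
  "('a, 'e::euclidean_space) chart set \<Rightarrow> 'a \<Rightarrow> ('a, 'e) tvec set" where
  "tangent_space \<A> p = {v.
     (\<forall>c\<in>\<A>. \<forall>d\<in>\<A>. p \<in> fst c \<longrightarrow> p \<in> fst d \<longrightarrow>
        comp_in v d = frechet_derivative (transition c d) (at (snd c p)) (comp_in v c)) \<and>
     (\<forall>c. c \<notin> \<A> \<or> p \<notin> fst c \<longrightarrow> comp_in v c = 0)}"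

text \<open>The tangent vector at \<open>p\<close> with components \<open>u\<close> in the chart \<open>c\<close>; for \<open>u = i \<in> Basis\<close> it is
  the \<open>i\<close>-th coordinate vector.\<close>

definition coord_vector ::
  "('a, 'e::euclidean_space) chart set \<Rightarrow> ('a, 'e) chart \<Rightarrow> 'a \<Rightarrow> 'e \<Rightarrow> ('a, 'e) tvec" where
  "coord_vector \<A> c p u = Tvec (\<lambda>d. if d \<in> \<A> \<and> p \<in> fst d
     then frechet_derivative (transition c d) (at (snd c p)) u else 0)"

section \<open>Tensor fields\<close>

text \<open>Fields are functions of the point (and of tangent vectors at that point); only their values
  at points of the manifold and on the tangent spaces matter.\<close>

definition vector_field ::
  "'a topology \<Rightarrow> ('a, 'e::euclidean_space) chart set \<Rightarrow> ('a \<Rightarrow> ('a, 'e) tvec) \<Rightarrow> bool" where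
  "vector_field X \<A> V \<longleftrightarrow>
     (\<forall>p\<in>topspace X. V p \<in> tangent_space \<A> p) \<and>
     (\<forall>c\<in>\<A>. smooth_on (snd c ` fst c) (\<lambda>x. comp_in (V (chart_inv c x)) c))"

definition one_form ::
  "'a topology \<Rightarrow> ('a, 'e::euclidean_space) chart set \<Rightarrow> ('a \<Rightarrow> ('a, 'e) tvec \<Rightarrow> real) \<Rightarrow> bool" where
  "one_form X \<A> b \<longleftrightarrow>
     (\<forall>p\<in>topspace X. \<forall>u\<in>tangent_space \<A> p. \<forall>v\<in>tangent_space \<A> p. \<forall>r.
        b p (u + v) = b p u + b p v \<and> b p (r *\<^sub>R u) = r * b p u) \<and>
     (\<forall>c\<in>\<A>. \<forall>i\<in>Basis. smooth_on (snd c ` fst c)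
        (\<lambda>x. b (chart_inv c x) (coord_vector \<A> c (chart_inv c x) i)))"

definition riemannian_metric ::
  "'a topology \<Rightarrow> ('a, 'e::euclidean_space) chart set
    \<Rightarrow> ('a \<Rightarrow> ('a, 'e) tvec \<Rightarrow> ('a, 'e) tvec \<Rightarrow> real) \<Rightarrow> bool" where
  "riemannian_metric X \<A> a \<longleftrightarrow>
     (\<forall>p\<in>topspace X. \<forall>u\<in>tangent_space \<A> p. \<forall>v\<in>tangent_space \<A> p. \<forall>w\<in>tangent_space \<A> p. \<forall>r.
        a p (u + v) w = a p u w + a p v w \<and> a p (r *\<^sub>R u) w = r * a p u w \<and>
        a p u v = a p v u \<and> (u \<noteq> 0 \<longrightarrow> a p u u > 0)) \<and>
     (\<forall>c\<in>\<A>. \<forall>i\<in>Basis. \<forall>j\<in>Basis. smooth_on (snd c ` fst c)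
        (\<lambda>x. a (chart_inv c x) (coord_vector \<A> c (chart_inv c x) i)
                                (coord_vector \<A> c (chart_inv c x) j)))"

text \<open>The vector \<open>b\<^sup>i = a\<^sup>i\<^sup>j b\<^sub>j\<close>, i.e. the solution of \<open>a\<^sub>i\<^sub>j b\<^sup>j = b\<^sub>i\<close>, and the norm
  \<open>sqrt (a\<^sup>i\<^sup>j b\<^sub>i b\<^sub>j)\<close> of the 1-form \<open>b\<close> with respect to \<open>a\<close>.\<close>

definition sharp ::
  "('a, 'e::euclidean_space) chart set \<Rightarrow> ('a \<Rightarrow> ('a, 'e) tvec \<Rightarrow> ('a, 'e) tvec \<Rightarrow> real)
    \<Rightarrow> ('a \<Rightarrow> ('a, 'e) tvec \<Rightarrow> real) \<Rightarrow> 'a \<Rightarrow> ('a, 'e) tvec" where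
  "sharp \<A> a b p = (THE w. w \<in> tangent_space \<A> p \<and> (\<forall>y\<in>tangent_space \<A> p. a p w y = b p y))"

definition form_norm ::
  "('a, 'e::euclidean_space) chart set \<Rightarrow> ('a \<Rightarrow> ('a, 'e) tvec \<Rightarrow> ('a, 'e) tvec \<Rightarrow> real)
    \<Rightarrow> ('a \<Rightarrow> ('a, 'e) tvec \<Rightarrow> real) \<Rightarrow> 'a \<Rightarrow> real" where
  "form_norm \<A> a b p = sqrt (b p (sharp \<A> a b p))"

section \<open>Randers and Kropina metrics\<close>

definition randers_metric ::
  "'a topology \<Rightarrow> ('a, 'e::euclidean_space) chart set
    \<Rightarrow> ('a \<Rightarrow> ('a, 'e) tvec \<Rightarrow> ('a, 'e) tvec \<Rightarrow> real) \<Rightarrow> ('a \<Rightarrow> ('a, 'e) tvec \<Rightarrow> real)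
    \<Rightarrow> ('a \<Rightarrow> ('a, 'e) tvec \<Rightarrow> real) \<Rightarrow> bool" where
  "randers_metric X \<A> a b F \<longleftrightarrow>
     riemannian_metric X \<A> a \<and> one_form X \<A> b \<and> (\<forall>p\<in>topspace X. form_norm \<A> a b p < 1) \<and>
     (\<forall>p\<in>topspace X. \<forall>y\<in>tangent_space \<A> p. F p y = sqrt (a p y y) + b p y)"

text \<open>A conic Kropina metric \<open>F\<close> comes with its domain \<open>A\<close> and is specified only there.\<close>

definition kropina_metric ::
  "'a topology \<Rightarrow> ('a, 'e::euclidean_space) chart set
    \<Rightarrow> ('a \<Rightarrow> ('a, 'e) tvec \<Rightarrow> ('a, 'e) tvec \<Rightarrow> real) \<Rightarrow> ('a \<Rightarrow> ('a, 'e) tvec \<Rightarrow> real)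
    \<Rightarrow> ('a \<Rightarrow> ('a, 'e) tvec \<Rightarrow> real) \<Rightarrow> ('a \<Rightarrow> ('a, 'e) tvec set) \<Rightarrow> bool" where
  "kropina_metric X \<A> a b F A \<longleftrightarrow>
     riemannian_metric X \<A> a \<and> one_form X \<A> b \<and>
     (\<forall>p\<in>topspace X. \<exists>y\<in>tangent_space \<A> p. b p y \<noteq> 0) \<and>
     (\<forall>p\<in>topspace X. A p = {y \<in> tangent_space \<A> p. b p y > 0}) \<and>
     (\<forall>p\<in>topspace X. \<forall>y\<in>A p. F p y = (sqrt (a p y y))\<^sup>2 / b p y)"

definition kropina_navigation_data ::
  "'a topology \<Rightarrow> ('a, 'e::euclidean_space) chart set
    \<Rightarrow> ('a \<Rightarrow> ('a, 'e) tvec \<Rightarrow> ('a, 'e) tvec \<Rightarrow> real) \<Rightarrow> ('a \<Rightarrow> ('a, 'e) tvec \<Rightarrow> real)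
    \<Rightarrow> ('a \<Rightarrow> ('a, 'e) tvec \<Rightarrow> ('a, 'e) tvec \<Rightarrow> real) \<Rightarrow> ('a \<Rightarrow> ('a, 'e) tvec) \<Rightarrow> bool" where
  "kropina_navigation_data X \<A> a b h W \<longleftrightarrow>
     (\<forall>p\<in>topspace X. \<forall>u\<in>tangent_space \<A> p. \<forall>v\<in>tangent_space \<A> p.
        h p u v = 4 / (form_norm \<A> a b p)\<^sup>2 * a p u v) \<and>
     (\<forall>p\<in>topspace X. W p = (1 / 2) *\<^sub>R sharp \<A> a b p)"

section \<open>The navigation problem\<close>

definition navigates ::
  "('a \<Rightarrow> ('a, 'e::euclidean_space) tvec \<Rightarrow> real) \<Rightarrow> ('a \<Rightarrow> ('a, 'e) tvec set)
    \<Rightarrow> ('a \<Rightarrow> ('a, 'e) tvec) \<Rightarrow> 'a \<Rightarrow> ('a, 'e) tvec \<Rightarrow> real \<Rightarrow> bool" where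
  "navigates F A V p y t \<longleftrightarrow> t > 0 \<and> y /\<^sub>R t - V p \<in> A p \<and> F p (y /\<^sub>R t - V p) = 1"

text \<open>The zero vector has to be excluded: if \<open>F p (- V p) = 1\<close>, then every \<open>t > 0\<close> solves the
  equation for \<open>y = 0\<close>.\<close>

definition navigation_domain ::
  "('a, 'e::euclidean_space) chart set \<Rightarrow> ('a \<Rightarrow> ('a, 'e) tvec \<Rightarrow> real)
    \<Rightarrow> ('a \<Rightarrow> ('a, 'e) tvec set) \<Rightarrow> ('a \<Rightarrow> ('a, 'e) tvec) \<Rightarrow> 'a \<Rightarrow> ('a, 'e) tvec set" where
  "navigation_domain \<A> F A V p =
     {y \<in> tangent_space \<A> p. y \<noteq> 0 \<and> (\<exists>t. navigates F A V p y t)}"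

definition navigation_solution ::
  "('a \<Rightarrow> ('a, 'e::euclidean_space) tvec \<Rightarrow> real) \<Rightarrow> ('a \<Rightarrow> ('a, 'e) tvec set)
    \<Rightarrow> ('a \<Rightarrow> ('a, 'e) tvec) \<Rightarrow> 'a \<Rightarrow> ('a, 'e) tvec \<Rightarrow> real" where
  "navigation_solution F A V p y = (THE t. navigates F A V p y t)"

section \<open>The navigation data of a Kropina metric\<close>

text \<open>The vector \<open>sharp \<A> a b p\<close> is well defined, and the navigation data represent the
  Kropina metric as \<open>h\<^sup>2 / (2 W\<^sub>0)\<close> with \<open>W\<close> of \<open>h\<close>-length 1.\<close>

lemma smooth_on_differentiable:
  "smooth_on S f \<Longrightarrow> x \<in> S \<Longrightarrow> f differentiable (at x)"
  unfolding smooth_on_def by (drule spec[of _ "Suc 0"]) simp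

context
  fixes X :: "'a topology" and \<A> :: "('a, 'e::euclidean_space) chart set"
  assumes M: "smooth_manifold X \<A>"
begin

lemma chart_inj: "c \<in> \<A> \<Longrightarrow> inj_on (snd c) (fst c)"
  and chart_open: "c \<in> \<A> \<Longrightarrow> d \<in> \<A> \<Longrightarrow> open (snd c ` (fst c \<inter> fst d))"
proof -
  assume c: "c \<in> \<A>"
  have op: "openin X (fst c)" and hm: "homeomorphic_map (subtopology X (fst c)) (top_of_set (snd c ` fst c)) (snd c)"
    and im: "open (snd c ` fst c)"
    using M c unfolding smooth_manifold_def by auto
  have ts: "topspace (subtopology X (fst c)) = fst c"
    using op by (meson openin_subset topspace_subtopology_subset)
  show "inj_on (snd c) (fst c)" using hm ts unfolding homeomorphic_map_def by simp
  assume d: "d \<in> \<A>"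
  have "openin X (fst d)" using M d unfolding smooth_manifold_def by auto
  hence "openin (subtopology X (fst c)) (fst c \<inter> fst d)"
    by (metis inf_commute openin_subtopology)
  hence "openin (top_of_set (snd c ` fst c)) (snd c ` (fst c \<inter> fst d))"
    using homeomorphic_imp_open_map[OF hm] unfolding open_map_def by blast
  thus "open (snd c ` (fst c \<inter> fst d))" using im openin_open_eq by blast
qed

lemma transition_at:
  "c \<in> \<A> \<Longrightarrow> p \<in> fst c \<Longrightarrow> chart_inv c (snd c p) = p"
  "c \<in> \<A> \<Longrightarrow> p \<in> fst c \<Longrightarrow> transition c d (snd c p) = snd d p"
  by (simp_all add: chart_inv_def transition_def the_inv_into_f_f chart_inj)

lemma transition_diff:
  assumes "c \<in> \<A>" "d \<in> \<A>" "p \<in> fst c" "p \<in> fst d"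
  shows "transition c d differentiable (at (snd c p))"
proof (rule smooth_on_differentiable)
  show "smooth_on (snd c ` (fst c \<inter> fst d)) (transition c d)"
    using M assms unfolding smooth_manifold_def by blast
qed (use assms in blast)

lemma transition_chain:
  assumes "c \<in> \<A>" "d \<in> \<A>" "e \<in> \<A>" "p \<in> fst c" "p \<in> fst d" "p \<in> fst e"
  shows "frechet_derivative (transition c e) (at (snd c p)) u =
    frechet_derivative (transition d e) (at (snd d p))
      (frechet_derivative (transition c d) (at (snd c p)) u)"
proof -
  let ?D1 = "frechet_derivative (transition c d) (at (snd c p))"
  let ?D2 = "frechet_derivative (transition d e) (at (snd d p))"
  have 1: "(transition c d has_derivative ?D1) (at (snd c p))"
    using transition_diff assms frechet_derivative_works by blast
  have 2: "(transition d e has_derivative ?D2) (at (transition c d (snd c p)))"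
    using transition_diff assms frechet_derivative_works transition_at(2) by metis
  have 3: "(transition d e \<circ> transition c d has_derivative ?D2 \<circ> ?D1) (at (snd c p))"
    using diff_chain_at[OF 1 2] .
  have "(transition c e has_derivative ?D2 \<circ> ?D1) (at (snd c p))"
  proof (rule has_derivative_transform_within_open[OF 3 chart_open[of c d]])
    fix x assume "x \<in> snd c ` (fst c \<inter> fst d)"
    then obtain q where "x = snd c q" "q \<in> fst c" "q \<in> fst d" by auto
    thus "(transition d e \<circ> transition c d) x = transition c e x"
      using assms by (simp add: transition_at)
  qed (use assms in auto)
  thus ?thesis using frechet_derivative_at by (metis comp_apply)
qed

lemma transition_id:
  assumes "c \<in> \<A>" "p \<in> fst c"
  shows "frechet_derivative (transition c c) (at (snd c p)) u = u"
proof -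
  have "(transition c c has_derivative id) (at (snd c p))"
  proof (rule has_derivative_transform_within_open[OF has_derivative_id chart_open[of c c]])
    fix x assume "x \<in> snd c ` (fst c \<inter> fst c)"
    thus "id x = transition c c x" using assms by (auto simp add: transition_at)
  qed (use assms in auto)
  thus ?thesis using frechet_derivative_at by (metis id_apply)
qed

lemma comp_coord_vector:
  "c \<in> \<A> \<Longrightarrow> p \<in> fst c \<Longrightarrow> comp_in (coord_vector \<A> c p u) c = u"
  by (simp add: coord_vector_def Tvec_inverse transition_id)

lemma coord_vector_tangent:
  "c \<in> \<A> \<Longrightarrow> p \<in> fst c \<Longrightarrow> coord_vector \<A> c p u \<in> tangent_space \<A> p"
  unfolding tangent_space_def mem_Collect_eq
  by (intro conjI ballI allI impI)
    (auto simp: coord_vector_def Tvec_inverse transition_chain[of c _ _ p u, symmetric])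

lemma coord_vector_comp:
  assumes "c \<in> \<A>" "p \<in> fst c" "v \<in> tangent_space \<A> p"
  shows "coord_vector \<A> c p (comp_in v c) = v"
proof -
  have "comp_in (coord_vector \<A> c p (comp_in v c)) d = comp_in v d" for d
  proof (cases "d \<in> \<A> \<and> p \<in> fst d")
    case True
    hence "comp_in v d = frechet_derivative (transition c d) (at (snd c p)) (comp_in v c)"
      using assms unfolding tangent_space_def by blast
    thus ?thesis using True by (simp add: coord_vector_def Tvec_inverse)
  next
    case False
    hence "comp_in v d = 0" using assms unfolding tangent_space_def by blast
    thus ?thesis using False by (auto simp: coord_vector_def Tvec_inverse)
  qed
  thus ?thesis by (metis comp_in_inject ext)
qed

lemma coord_vector_linear:
  assumes "c \<in> \<A>" "p \<in> fst c"
  shows "linear (coord_vector \<A> c p)"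
proof -
  have L: "linear (frechet_derivative (transition c d) (at (snd c p)))" if "d \<in> \<A>" "p \<in> fst d" for d
    using transition_diff[OF assms(1) that(1) assms(2) that(2)] by (rule linear_frechet_derivative)
  show ?thesis
  proof (rule linearI)
    fix u v :: 'e and r :: real
    have "comp_in (coord_vector \<A> c p (u + v)) =
        comp_in (coord_vector \<A> c p u + coord_vector \<A> c p v)"
      by (rule ext) (simp add: coord_vector_def Tvec_inverse plus_tvec.rep_eq linear_add[OF L])
    thus "coord_vector \<A> c p (u + v) = coord_vector \<A> c p u + coord_vector \<A> c p v"
      by (simp only: comp_in_inject)
    have "comp_in (coord_vector \<A> c p (r *\<^sub>R u)) = comp_in (r *\<^sub>R coord_vector \<A> c p u)"
      by (rule ext) (simp add: coord_vector_def Tvec_inverse scaleR_tvec.rep_eq linear_scale[OF L])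
    thus "coord_vector \<A> c p (r *\<^sub>R u) = r *\<^sub>R coord_vector \<A> c p u"
      by (simp only: comp_in_inject)
  qed
qed

lemma tangent_subspace: assumes "p \<in> topspace X" shows "subspace (tangent_space \<A> p)"
proof -
  obtain c where c: "c \<in> \<A>" "p \<in> fst c" using M assms unfolding smooth_manifold_def by blast
  have "tangent_space \<A> p = range (coord_vector \<A> c p)"
  proof (intro equalityI subsetI)
    fix v assume "v \<in> tangent_space \<A> p"
    from coord_vector_comp[OF c this] show "v \<in> range (coord_vector \<A> c p)"
      by (metis rangeI)
  qed (auto intro: coord_vector_tangent[OF c])
  thus ?thesis using coord_vector_linear[OF c] by (simp add: linear_subspace_image)
qed

lemma riemannian_metricD:
  assumes "riemannian_metric X \<A> a" "p \<in> topspace X"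
    and "u \<in> tangent_space \<A> p" "v \<in> tangent_space \<A> p" "w \<in> tangent_space \<A> p"
  shows "a p (u + v) w = a p u w + a p v w" "a p (r *\<^sub>R u) w = r * a p u w"
    "a p u v = a p v u" "u \<noteq> 0 \<Longrightarrow> a p u u > 0"
proof -
  have "\<forall>u\<in>tangent_space \<A> p. \<forall>v\<in>tangent_space \<A> p. \<forall>w\<in>tangent_space \<A> p. \<forall>r.
        a p (u + v) w = a p u w + a p v w \<and> a p (r *\<^sub>R u) w = r * a p u w \<and>
        a p u v = a p v u \<and> (u \<noteq> 0 \<longrightarrow> a p u u > 0)"
    using assms(1)[unfolded riemannian_metric_def, THEN conjunct1] assms(2) by (rule bspec)
  note * = this[THEN bspec, OF assms(3), THEN bspec, OF assms(4), THEN bspec, OF assms(5), THEN spec, of r]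
  from * show "a p (u + v) w = a p u w + a p v w" "a p (r *\<^sub>R u) w = r * a p u w"
    "a p u v = a p v u" "u \<noteq> 0 \<Longrightarrow> a p u u > 0" by simp_all
qed

lemma one_formD:
  assumes "one_form X \<A> b" "p \<in> topspace X" "u \<in> tangent_space \<A> p" "v \<in> tangent_space \<A> p"
  shows "b p (u + v) = b p u + b p v" "b p (r *\<^sub>R u) = r * b p u"
proof -
  have "\<forall>u\<in>tangent_space \<A> p. \<forall>v\<in>tangent_space \<A> p. \<forall>r.
        b p (u + v) = b p u + b p v \<and> b p (r *\<^sub>R u) = r * b p u"
    using assms(1)[unfolded one_form_def, THEN conjunct1] assms(2) by (rule bspec)
  note * = this[THEN bspec, OF assms(3), THEN bspec, OF assms(4), THEN spec, of r]
  from * show "b p (u + v) = b p u + b p v" "b p (r *\<^sub>R u) = r * b p u" by simp_all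
qed

lemma sharp_works:
  assumes a: "riemannian_metric X \<A> a" and b: "one_form X \<A> b" and p: "p \<in> topspace X"
  shows "sharp \<A> a b p \<in> tangent_space \<A> p \<and> (\<forall>y\<in>tangent_space \<A> p. a p (sharp \<A> a b p) y = b p y)"
proof -
  obtain c where c: "c \<in> \<A>" "p \<in> fst c" using M p unfolding smooth_manifold_def by blast
  let ?T = "tangent_space \<A> p"
  let ?v = "coord_vector \<A> c p"
  note S = tangent_subspace[OF p]
  have a1: "a p (u + v) w = a p u w + a p v w" "a p (r *\<^sub>R u) w = r * a p u w" "a p u v = a p v u"
    "u \<noteq> 0 \<Longrightarrow> a p u u > 0" if "u \<in> ?T" "v \<in> ?T" "w \<in> ?T" for u v w r
    using riemannian_metricD[OF a p that] by simp_all
  have b1: "b p (u + v) = b p u + b p v" "b p (r *\<^sub>R u) = r * b p u" if "u \<in> ?T" "v \<in> ?T" for u v r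
    using one_formD[OF b p that] by simp_all
  have vT: "?v u \<in> ?T" for u using coord_vector_tangent[OF c] .
  note L = coord_vector_linear[OF c]
  define g where "g u w = a p (?v u) (?v w)" for u w
  have gl: "linear (\<lambda>u. g u w)" for w
    by (rule linearI) (simp_all add: g_def linear_add[OF L] linear_scale[OF L] a1(1,2)[OF vT vT vT])
  have gs: "g u w = g w u" for u w using a1(3)[OF vT vT vT] by (simp add: g_def)
  have gr: "linear (\<lambda>w. g u w)" for u using gl[of u] gs by simp
  have bl: "linear (\<lambda>w. b p (?v w))"
    by (rule linearI) (simp_all add: linear_add[OF L] linear_scale[OF L] b1[OF vT vT])
  define G where "G u = (\<Sum>i\<in>Basis. g u i *\<^sub>R i)" for u
  have Gi: "G u \<bullet> w = g u w" for u w
  proof -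
    have "g u w = g u (\<Sum>i\<in>Basis. (w \<bullet> i) *\<^sub>R i)" by (simp add: euclidean_representation)
    also have "\<dots> = (\<Sum>i\<in>Basis. (w \<bullet> i) * g u i)"
      by (simp add: linear_sum[OF gr] linear_scale[OF gr])
    also have "\<dots> = G u \<bullet> w" unfolding G_def inner_sum_left
      by (rule sum.cong) (auto simp: inner_commute mult.commute)
    finally show ?thesis ..
  qed
  have "linear G" by (rule linearI) (auto simp: G_def linear_add[OF gl] linear_scale[OF gl] scaleR_add_left sum.distrib scaleR_sum_right)
  moreover have "inj G"
  proof (rule linear_injective_0[OF \<open>linear G\<close>, THEN iffD2], intro allI impI)
    fix u assume "G u = 0"
    hence "a p (?v u) (?v u) = 0" using Gi[of u u] by (simp add: g_def)
    hence "?v u = 0" using a1(4)[OF vT vT vT, of u] by fastforce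
    thus "u = 0" using comp_coord_vector[OF c, of u] by (simp add: zero_tvec.rep_eq)
  qed
  ultimately have "surj G" using linear_injective_imp_surjective by blast
  then obtain u where u: "G u = (\<Sum>i\<in>Basis. b p (?v i) *\<^sub>R i)" by (metis surjD)
  have "g u w = b p (?v w)" for w
  proof -
    have "b p (?v w) = b p (?v (\<Sum>i\<in>Basis. (w \<bullet> i) *\<^sub>R i))" by (simp add: euclidean_representation)
    also have "\<dots> = (\<Sum>i\<in>Basis. (w \<bullet> i) * b p (?v i))"
      by (simp add: linear_sum[OF bl] linear_scale[OF bl])
    also have "\<dots> = G u \<bullet> w" unfolding u inner_sum_left
      by (rule sum.cong) (auto simp: inner_commute mult.commute)
    finally show ?thesis using Gi by simp
  qed
  hence ex: "?v u \<in> ?T \<and> (\<forall>y\<in>?T. a p (?v u) y = b p y)"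
    using vT coord_vector_comp[OF c] by (metis g_def)
  have un: "w = w'" if w: "w \<in> ?T \<and> (\<forall>y\<in>?T. a p w y = b p y)" "w' \<in> ?T \<and> (\<forall>y\<in>?T. a p w' y = b p y)" for w w'
  proof (rule ccontr)
    assume "w \<noteq> w'"
    let ?d = "w + (-1) *\<^sub>R w'"
    have d: "?d \<in> ?T" using S w by (simp add: subspace_diff)
    have "?d \<noteq> 0" using \<open>w \<noteq> w'\<close> by simp
    hence "a p ?d ?d > 0" using a1(4)[OF d d d] by blast
    moreover have w'm: "(-1) *\<^sub>R w' \<in> ?T" using S w by (metis subspace_scale)
    hence "a p ?d ?d = a p w ?d + a p ((-1) *\<^sub>R w') ?d" using a1(1)[of w "(-1) *\<^sub>R w'" ?d] w d by blast
    moreover have "a p ((-1) *\<^sub>R w') ?d = - a p w' ?d" using a1(2)[of w' w' ?d "-1"] w d by auto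
    ultimately show False using w d by force
  qed
  show ?thesis unfolding sharp_def by (rule theI[of _ "?v u"]) (use ex un in blast)+
qed

lemma kropina_navigation:
  assumes F: "kropina_metric X \<A> a b F A"
    and hW: "kropina_navigation_data X \<A> a b h W" and p: "p \<in> topspace X"
  shows "W p \<in> tangent_space \<A> p" and "h p (W p) (W p) = 1"
    and "A p = {y \<in> tangent_space \<A> p. h p y (W p) > 0}"
    and "\<And>y. y \<in> A p \<Longrightarrow> F p y = h p y y / (2 * h p (W p) y)"
proof -
  let ?T = "tangent_space \<A> p"
  let ?s = "sharp \<A> a b p"
  have a: "riemannian_metric X \<A> a" and b: "one_form X \<A> b" using F unfolding kropina_metric_def by auto
  note S = tangent_subspace[OF p]
  have s: "?s \<in> ?T" "\<And>y. y \<in> ?T \<Longrightarrow> a p ?s y = b p y" using sharp_works[OF a b p] by auto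
  have W: "W p = (1/2) *\<^sub>R ?s" using hW p unfolding kropina_navigation_data_def by blast
  show WT: "W p \<in> ?T" using W s S by (metis subspace_scale)
  have sc: "a p (r *\<^sub>R u) w = r * a p u w" "a p u w = a p w u" "u \<noteq> 0 \<Longrightarrow> a p u u > 0" if "u \<in> ?T" "w \<in> ?T" for u w r
    using riemannian_metricD[OF a p that(1,2,2)] by simp_all
  obtain y0 where y0: "y0 \<in> ?T" "b p y0 \<noteq> 0" using F p unfolding kropina_metric_def by auto
  have "?s \<noteq> 0"
  proof
    assume "?s = 0"
    hence "b p y0 = a p (0 *\<^sub>R ?s) y0" using s y0 by simp
    also have "\<dots> = 0" using sc(1)[OF s(1) y0(1), of 0] by simp
    finally show False using y0 by simp
  qed
  hence pos: "b p ?s > 0" using sc(3)[OF s(1) s(1)] s by auto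
  define B where "B = b p ?s"
  have n: "(form_norm \<A> a b p)\<^sup>2 = B" unfolding form_norm_def B_def using pos by simp
  have B: "B > 0" using pos B_def by simp
  have h: "h p u v = 4 / B * a p u v" if "u \<in> ?T" "v \<in> ?T" for u v
    using hW p that n unfolding kropina_navigation_data_def by force
  have aW: "a p (W p) y = b p y / 2" if "y \<in> ?T" for y
    using sc(1)[OF s(1) that, of "1/2"] s(2)[OF that] W by simp
  have hWy: "h p (W p) y = 2 * b p y / B" if "y \<in> ?T" for y
    using h[OF WT that] aW[OF that] by simp
  have "a p (W p) (W p) = B / 4"
    using aW[OF WT] sc(2)[OF WT s(1)] aW[OF s(1)] s(2)[OF WT] by (simp add: B_def)
  thus "h p (W p) (W p) = 1" using h[OF WT WT] B by simp
  have hyW: "h p y (W p) = h p (W p) y" if "y \<in> ?T" for y using h that WT sc(2) by metis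
  have Ap: "A p = {y \<in> ?T. b p y > 0}" using F p unfolding kropina_metric_def by blast
  show "A p = {y \<in> ?T. h p y (W p) > 0}" 
    unfolding Ap
  proof (rule Collect_cong, rule conj_cong[OF refl])
    fix y assume "y \<in> ?T"
    thus "b p y > 0 \<longleftrightarrow> h p y (W p) > 0"
      using hyW[of y] hWy[of y] B by (simp add: zero_less_divide_iff)
  qed
  fix y assume y: "y \<in> A p"
  hence yT: "y \<in> ?T" "b p y > 0" using Ap by auto
  have "0 \<le> a p y y"
  proof (cases "y = 0")
    case True thus ?thesis using sc(1)[OF yT(1) yT(1), of 0] by simp
  next case False thus ?thesis using sc(3)[OF yT(1) yT(1)] by simp
  qed
  hence "F p y = a p y y / b p y" using F p y unfolding kropina_metric_def by simp
  also have "\<dots> = h p y y / (2 * h p (W p) y)" using B yT by (simp add: h[OF yT(1) yT(1)] hWy[OF yT(1)])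
  finally show "F p y = h p y y / (2 * h p (W p) y)" .
qed

end

end

theory Submission
  imports Defs
begin

text \<open>
  Write \<open>F = \<alpha>\<^sup>2 / \<beta>\<close>. Where \<open>\<beta> > 0\<close>, the condition \<open>F(u) = 1\<close> says \<open>a(u,u) = \<beta>(u)\<close>, a quadric through
  the origin. Putting \<open>u = y/t - V\<close> and multiplying by \<open>t\<^sup>2\<close> turns the navigation equation into
  \<open>\<lambda> t\<^sup>2 + \<theta>(y) t = a(y,y)\<close> with
  \<open>\<theta> = 2 a(V,\<cdot>) + \<beta>\<close> and \<open>\<lambda> = -(a(V,V) + \<beta>(V))\<close> (lemma \<open>navigation_quadratic\<close>).
  As \<open>\<beta>(-V) > 0\<close>, the sign of \<open>\<lambda>\<close> is that of \<open>1 - F(-V)\<close>. So \<open>\<lambda> \<ge> 0\<close>, and as \<open>a(y,y) > 0\<close> for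
  \<open>y \<noteq> 0\<close>, there is at most one positive root.

  If \<open>\<lambda> > 0\<close>, this root is \<open>t = b'(y) + sqrt (a(y,y)/\<lambda> + b'(y)\<^sup>2)\<close> with \<open>b' = -\<theta>/(2\<lambda>)\<close>. This is
  the Randers metric of \<open>a' = a/\<lambda> + b' \<otimes> b'\<close> and \<open>b'\<close>; the norm of \<open>b'\<close> is below 1 because
  \<open>a' - b' \<otimes> b'\<close> is positive definite (lemma \<open>form_norm_add_square\<close>).
  If \<open>\<lambda> = 0\<close>, the equation is linear in \<open>t\<close> and its solution is the Kropina metric
  \<open>a(y,y)/\<theta>(y)\<close>; here \<open>\<theta>\<close> vanishes nowhere since \<open>\<theta>(V) = a(V,V) - \<lambda> = a(V,V) > 0\<close>.

  The rest is smoothness of the coefficients of \<open>a'\<close>, \<open>b'\<close> and \<open>\<theta>\<close> in a chart. They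
  are obtained from smooth functions by sums, products and reciprocals.
\<close>

section \<open>Calculus of smooth functions on open sets\<close>

lemma Ck_on_cong:
  assumes "open S" "\<And>x. x \<in> S \<Longrightarrow> f x = g x" "Ck_on k S f"
  shows "Ck_on k S g"
  using assms(2,3)
proof (induction k arbitrary: f g)
  case 0
  then show ?case by (metis Ck_on.simps(1) continuous_on_cong)
next
  case (Suc k)
  have D: "(g has_derivative frechet_derivative f (at x)) (at x)" if "x \<in> S" for x
  proof -
    have "(f has_derivative frechet_derivative f (at x)) (at x)"
      using Suc.prems(2) that by (auto simp: frechet_derivative_works)
    then show ?thesis
      by (rule has_derivative_transform_within_open[OF _ \<open>open S\<close> that Suc.prems(1)])
  qed
  have "frechet_derivative f (at x) v = frechet_derivative g (at x) v" if "x \<in> S" for x v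
    using frechet_derivative_at[OF D[OF that]] by simp
  then have "Ck_on k S (\<lambda>x. frechet_derivative g (at x) v)" for v
    using Suc.IH[of "\<lambda>x. frechet_derivative f (at x) v"] Suc.prems(2) by simp
  then show ?case using D by (auto simp: differentiable_def)
qed

text \<open>Derivatives of sums, products and reciprocals come from \<open>has_derivative\<close> rules; this rule
  lets them enter an induction on \<open>k\<close> without evaluating \<open>frechet_derivative\<close>.\<close>

lemma Ck_on_SucI:
  assumes "open S" "\<And>x. x \<in> S \<Longrightarrow> (f has_derivative D x) (at x)" "\<And>v. Ck_on k S (\<lambda>x. D x v)"
  shows "Ck_on (Suc k) S f"
proof -
  have "D x v = frechet_derivative f (at x) v" if "x \<in> S" for x v
    using frechet_derivative_at[OF assms(2)[OF that]] by simp
  then have "Ck_on k S (\<lambda>x. frechet_derivative f (at x) v)" for v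
    by (intro Ck_on_cong[OF assms(1) _ assms(3)[of v]])
  then show ?thesis using assms(2) by (auto simp: differentiable_def)
qed

lemma Ck_on_has_derivative:
  "Ck_on (Suc k) S f \<Longrightarrow> x \<in> S \<Longrightarrow> (f has_derivative frechet_derivative f (at x)) (at x)"
  by (auto simp: frechet_derivative_works)

lemma Ck_on_Suc_imp: "Ck_on (Suc k) S f \<Longrightarrow> Ck_on k S f"
proof (induction k arbitrary: f)
  case 0
  then show ?case
    by (auto intro!: differentiable_imp_continuous_on
        simp: differentiable_on_def differentiable_at_withinI)
next
  case (Suc k)
  then show ?case by (metis Ck_on.simps(2))
qed

lemma Ck_on_const: "Ck_on k S (\<lambda>x. c)"
  by (induction k arbitrary: c) (simp_all add: frechet_derivative_const)

lemma Ck_on_add: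
  assumes "open S" "Ck_on k S f" "Ck_on k S g"
  shows "Ck_on k S (\<lambda>x. f x + g x)"
  using assms(2,3)
proof (induction k arbitrary: f g)
  case 0
  then show ?case by (simp add: continuous_on_add)
next
  case (Suc k)
  show ?case
    by (rule Ck_on_SucI[OF \<open>open S\<close> has_derivative_add])
      (use Suc in \<open>auto intro: Ck_on_has_derivative\<close>)
qed

lemma Ck_on_mult:
  fixes f g :: "_ \<Rightarrow> real"
  assumes "open S" "Ck_on k S f" "Ck_on k S g"
  shows "Ck_on k S (\<lambda>x. f x * g x)"
  using assms(2,3)
proof (induction k arbitrary: f g)
  case 0
  then show ?case by (simp add: continuous_on_mult)
next
  case (Suc k)
  have "Ck_on k S f" "Ck_on k S g" using Suc.prems by (auto intro: Ck_on_Suc_imp)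
  then have "Ck_on k S (\<lambda>x. f x * frechet_derivative g (at x) v + frechet_derivative f (at x) v * g x)" for v
    using Suc by (intro Ck_on_add[OF \<open>open S\<close>] Suc.IH) auto
  then show ?case
    by (intro Ck_on_SucI[OF \<open>open S\<close> has_derivative_mult])
      (use Suc in \<open>auto intro: Ck_on_has_derivative\<close>)
qed

lemma Ck_on_inverse:
  fixes f :: "_ \<Rightarrow> real"
  assumes "open S" "Ck_on k S f" "\<And>x. x \<in> S \<Longrightarrow> f x \<noteq> 0"
  shows "Ck_on k S (\<lambda>x. inverse (f x))"
  using assms(2)
proof (induction k)
  case 0
  then show ?case using assms(3) by (auto intro: continuous_on_inverse)
next
  case (Suc k)
  have i: "Ck_on k S (\<lambda>x. inverse (f x))" using Suc.IH[OF Ck_on_Suc_imp[OF Suc.prems]] .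
  have f': "Ck_on k S (\<lambda>x. frechet_derivative f (at x) v)" for v
    using Suc.prems by simp
  have "Ck_on k S (\<lambda>x. (- 1) * (inverse (f x) * frechet_derivative f (at x) v * inverse (f x)))" for v
    by (rule Ck_on_mult[OF \<open>open S\<close> Ck_on_const Ck_on_mult[OF \<open>open S\<close> Ck_on_mult[OF \<open>open S\<close> i f'] i]])
  then have *: "Ck_on k S (\<lambda>x. - (inverse (f x) * frechet_derivative f (at x) v * inverse (f x)))" for v
    by simp
  show ?case
    by (rule Ck_on_SucI[OF \<open>open S\<close> _ *])
      (rule Deriv.has_derivative_inverse[OF assms(3) Ck_on_has_derivative[OF Suc.prems]])
qed

lemma Ck_on_inner_left:
  fixes f :: "_ \<Rightarrow> 'f::real_inner"
  assumes "open S" "Ck_on k S f"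
  shows "Ck_on k S (\<lambda>x. f x \<bullet> i)"
  using assms(2)
proof (induction k arbitrary: f)
  case 0
  then show ?case by (simp add: continuous_on_inner)
next
  case (Suc k)
  show ?case
    by (rule Ck_on_SucI[OF \<open>open S\<close> has_derivative_inner_left])
      (use Suc in \<open>auto intro: Ck_on_has_derivative\<close>)
qed

lemma smooth_on_cong:
  "open S \<Longrightarrow> (\<And>x. x \<in> S \<Longrightarrow> f x = g x) \<Longrightarrow> smooth_on S f \<Longrightarrow> smooth_on S g"
  unfolding smooth_on_def by (blast intro: Ck_on_cong)

lemma smooth_on_const: "smooth_on S (\<lambda>x. c)"
  unfolding smooth_on_def by (blast intro: Ck_on_const)

lemma smooth_on_add:
  "open S \<Longrightarrow> smooth_on S f \<Longrightarrow> smooth_on S g \<Longrightarrow> smooth_on S (\<lambda>x. f x + g x)"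
  unfolding smooth_on_def by (blast intro: Ck_on_add)

lemma smooth_on_mult:
  fixes f g :: "_ \<Rightarrow> real"
  shows "open S \<Longrightarrow> smooth_on S f \<Longrightarrow> smooth_on S g \<Longrightarrow> smooth_on S (\<lambda>x. f x * g x)"
  unfolding smooth_on_def by (blast intro: Ck_on_mult)

lemma smooth_on_inverse:
  fixes f :: "_ \<Rightarrow> real"
  shows "open S \<Longrightarrow> smooth_on S f \<Longrightarrow> (\<And>x. x \<in> S \<Longrightarrow> f x \<noteq> 0) \<Longrightarrow> smooth_on S (\<lambda>x. inverse (f x))"
  unfolding smooth_on_def by (blast intro: Ck_on_inverse)

lemma smooth_on_inner_left: "open S \<Longrightarrow> smooth_on S f \<Longrightarrow> smooth_on S (\<lambda>x. f x \<bullet> i)"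
  unfolding smooth_on_def by (blast intro: Ck_on_inner_left)

lemma smooth_on_sum:
  assumes "open S" "finite I" "\<And>i. i \<in> I \<Longrightarrow> smooth_on S (f i)"
  shows "smooth_on S (\<lambda>x. \<Sum>i\<in>I. f i x)"
  using assms(2,3) by induction (auto intro: smooth_on_const smooth_on_add[OF assms(1)])

section \<open>Operations on tensor fields\<close>

definition smooth_function ::
  "('a, 'e::euclidean_space) chart set \<Rightarrow> ('a \<Rightarrow> real) \<Rightarrow> bool" where
  "smooth_function \<A> f \<longleftrightarrow> (\<forall>c\<in>\<A>. smooth_on (snd c ` fst c) (\<lambda>x. f (chart_inv c x)))"

lemma smooth_function_const: "smooth_function \<A> (\<lambda>p. r)"
  unfolding smooth_function_def by (simp add: smooth_on_const)

lemma one_formI: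
  assumes "\<And>p u v. p \<in> topspace X \<Longrightarrow> u \<in> tangent_space \<A> p \<Longrightarrow> v \<in> tangent_space \<A> p \<Longrightarrow>
      b p (u + v) = b p u + b p v"
    and "\<And>p u r. p \<in> topspace X \<Longrightarrow> u \<in> tangent_space \<A> p \<Longrightarrow> b p (r *\<^sub>R u) = r * b p u"
    and "\<And>c i. c \<in> \<A> \<Longrightarrow> i \<in> Basis \<Longrightarrow> smooth_on (snd c ` fst c)
        (\<lambda>x. b (chart_inv c x) (coord_vector \<A> c (chart_inv c x) i))"
  shows "one_form X \<A> b"
  using assms unfolding one_form_def by simp

lemma one_form_smooth:
  "one_form X \<A> b \<Longrightarrow> c \<in> \<A> \<Longrightarrow> i \<in> Basis \<Longrightarrow>
    smooth_on (snd c ` fst c) (\<lambda>x. b (chart_inv c x) (coord_vector \<A> c (chart_inv c x) i))"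
  unfolding one_form_def by blast

lemma riemannian_metricI:
  assumes "\<And>p u v w. p \<in> topspace X \<Longrightarrow> u \<in> tangent_space \<A> p \<Longrightarrow> v \<in> tangent_space \<A> p \<Longrightarrow>
      w \<in> tangent_space \<A> p \<Longrightarrow> a p (u + v) w = a p u w + a p v w"
    and "\<And>p u w r. p \<in> topspace X \<Longrightarrow> u \<in> tangent_space \<A> p \<Longrightarrow> w \<in> tangent_space \<A> p \<Longrightarrow>
      a p (r *\<^sub>R u) w = r * a p u w"
    and "\<And>p u v. p \<in> topspace X \<Longrightarrow> u \<in> tangent_space \<A> p \<Longrightarrow> v \<in> tangent_space \<A> p \<Longrightarrow>
      a p u v = a p v u"
    and "\<And>p u. p \<in> topspace X \<Longrightarrow> u \<in> tangent_space \<A> p \<Longrightarrow> u \<noteq> 0 \<Longrightarrow> a p u u > 0"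
    and "\<And>c i j. c \<in> \<A> \<Longrightarrow> i \<in> Basis \<Longrightarrow> j \<in> Basis \<Longrightarrow> smooth_on (snd c ` fst c)
        (\<lambda>x. a (chart_inv c x) (coord_vector \<A> c (chart_inv c x) i)
                               (coord_vector \<A> c (chart_inv c x) j))"
  shows "riemannian_metric X \<A> a"
  unfolding riemannian_metric_def
  by (intro conjI ballI allI impI; rule assms; assumption)

lemma riemannian_metric_smooth:
  "riemannian_metric X \<A> a \<Longrightarrow> c \<in> \<A> \<Longrightarrow> i \<in> Basis \<Longrightarrow> j \<in> Basis \<Longrightarrow>
    smooth_on (snd c ` fst c) (\<lambda>x. a (chart_inv c x) (coord_vector \<A> c (chart_inv c x) i)
                                                     (coord_vector \<A> c (chart_inv c x) j))"
  unfolding riemannian_metric_def by (drule conjunct2) (drule (1) bspec)+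

lemma vector_field_tangent:
  "vector_field X \<A> V \<Longrightarrow> p \<in> topspace X \<Longrightarrow> V p \<in> tangent_space \<A> p"
  unfolding vector_field_def by blast

context
  fixes X :: "'a topology" and \<A> :: "('a, 'e::euclidean_space) chart set"
  assumes M: "smooth_manifold X \<A>"
begin

lemma chart_image_open: "c \<in> \<A> \<Longrightarrow> open (snd c ` fst c)"
  using M unfolding smooth_manifold_def by blast

lemma chart_inv_in:
  assumes "c \<in> \<A>" "x \<in> snd c ` fst c"
  shows "chart_inv c x \<in> fst c" and "chart_inv c x \<in> topspace X"
proof -
  show *: "chart_inv c x \<in> fst c"
    using assms transition_at(1)[OF M assms(1)] by auto
  then show "chart_inv c x \<in> topspace X"
    using M assms(1) unfolding smooth_manifold_def by blast
qed

lemma smooth_function_mult: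
  "smooth_function \<A> f \<Longrightarrow> smooth_function \<A> g \<Longrightarrow> smooth_function \<A> (\<lambda>p. f p * g p)"
  unfolding smooth_function_def by (auto intro: smooth_on_mult chart_image_open)

lemma smooth_function_inverse:
  assumes "smooth_function \<A> f" "\<And>p. p \<in> topspace X \<Longrightarrow> f p \<noteq> 0"
  shows "smooth_function \<A> (\<lambda>p. inverse (f p))"
  using assms chart_inv_in(2) unfolding smooth_function_def
  by (auto intro!: smooth_on_inverse chart_image_open)

lemma metric_rules:
  assumes "riemannian_metric X \<A> a" "p \<in> topspace X"
    and u: "u \<in> tangent_space \<A> p" and w: "w \<in> tangent_space \<A> p"
  shows "v \<in> tangent_space \<A> p \<Longrightarrow> a p (u + v) w = a p u w + a p v w"
    and "v \<in> tangent_space \<A> p \<Longrightarrow> a p w (u + v) = a p w u + a p w v"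
    and "a p (r *\<^sub>R u) w = r * a p u w" "a p w (r *\<^sub>R u) = r * a p w u"
    and "a p u w = a p w u" and "u \<noteq> 0 \<Longrightarrow> a p u u > 0"
proof -
  note R = riemannian_metricD[OF M assms(1,2)]
  have ru: "r *\<^sub>R u \<in> tangent_space \<A> p"
    using tangent_subspace[OF M assms(2)] u by (rule subspace_scale)
  show "a p u w = a p w u" "u \<noteq> 0 \<Longrightarrow> a p u u > 0" "a p (r *\<^sub>R u) w = r * a p u w"
    using R[OF u w w] by blast+
  then show "a p w (r *\<^sub>R u) = r * a p w u" using R(3)[OF ru w w] by simp
  assume v: "v \<in> tangent_space \<A> p"
  have uv: "u + v \<in> tangent_space \<A> p"
    using tangent_subspace[OF M assms(2)] u v by (rule subspace_add)
  show *: "a p (u + v) w = a p u w + a p v w" using R(1)[OF u v w] .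
  show "a p w (u + v) = a p w u + a p w v"
    using * R(3)[OF uv w w] R(3)[OF u w w] R(3)[OF v w w] by simp
qed

lemma form_rules:
  assumes "one_form X \<A> b" "p \<in> topspace X" "u \<in> tangent_space \<A> p"
  shows "v \<in> tangent_space \<A> p \<Longrightarrow> b p (u + v) = b p u + b p v"
    and "b p (r *\<^sub>R u) = r * b p u"
  using one_formD[OF M assms(1,2,3)] assms(3) by blast+

lemma one_form_add:
  assumes b: "one_form X \<A> b" and b': "one_form X \<A> b'"
  shows "one_form X \<A> (\<lambda>p y. b p y + b' p y)"
proof (rule one_formI)
  fix c :: "('a, 'e) chart" and i :: 'e assume c: "c \<in> \<A>" and i: "i \<in> Basis"
  let ?q = "chart_inv c"
  show "smooth_on (snd c ` fst c)
      (\<lambda>x. b (?q x) (coord_vector \<A> c (?q x) i) + b' (?q x) (coord_vector \<A> c (?q x) i))"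
    by (rule smooth_on_add[OF chart_image_open[OF c] one_form_smooth[OF b c i] one_form_smooth[OF b' c i]])
qed (simp_all add: form_rules[OF b] form_rules[OF b'] algebra_simps)

lemma one_form_scale:
  assumes f: "smooth_function \<A> f" and b: "one_form X \<A> b"
  shows "one_form X \<A> (\<lambda>p y. f p * b p y)"
proof (rule one_formI)
  fix c :: "('a, 'e) chart" and i :: 'e assume c: "c \<in> \<A>" and i: "i \<in> Basis"
  let ?q = "chart_inv c"
  have "smooth_on (snd c ` fst c) (\<lambda>x. f (?q x))"
    using f c unfolding smooth_function_def by blast
  then show "smooth_on (snd c ` fst c) (\<lambda>x. f (?q x) * b (?q x) (coord_vector \<A> c (?q x) i))"
    by (rule smooth_on_mult[OF chart_image_open[OF c] _ one_form_smooth[OF b c i]])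
qed (simp_all add: form_rules[OF b] algebra_simps)

lemma one_form_in_chart:
  assumes b: "one_form X \<A> b" and c: "c \<in> \<A>" "p \<in> fst c" and v: "v \<in> tangent_space \<A> p"
  shows "b p v = (\<Sum>i\<in>Basis. (comp_in v c \<bullet> i) * b p (coord_vector \<A> c p i))"
proof -
  have p: "p \<in> topspace X" using M c unfolding smooth_manifold_def by blast
  note T = coord_vector_tangent[OF M c] and L = coord_vector_linear[OF M c]
  have l: "linear (\<lambda>u. b p (coord_vector \<A> c p u))"
    by (rule linearI) (simp_all add: linear_add[OF L] linear_scale[OF L] form_rules[OF b p T] T)
  have "b p v = b p (coord_vector \<A> c p (\<Sum>i\<in>Basis. (comp_in v c \<bullet> i) *\<^sub>R i))"
    by (simp add: euclidean_representation coord_vector_comp[OF M c v])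
  also have "\<dots> = (\<Sum>i\<in>Basis. (comp_in v c \<bullet> i) * b p (coord_vector \<A> c p i))"
    by (simp add: linear_sum[OF l] linear_scale[OF l])
  finally show ?thesis .
qed

lemma vector_field_smooth:
  assumes "vector_field X \<A> V" "c \<in> \<A>"
  shows "smooth_on (snd c ` fst c) (\<lambda>x. comp_in (V (chart_inv c x)) c \<bullet> i)"
  using assms chart_image_open unfolding vector_field_def by (auto intro: smooth_on_inner_left)

text \<open>In a chart this function is \<open>b\<^sub>i V\<^sup>i\<close>, a sum of products of smooth components.\<close>

lemma smooth_function_pairing:
  assumes b: "one_form X \<A> b" and V: "vector_field X \<A> V"
  shows "smooth_function \<A> (\<lambda>p. b p (V p))"
  unfolding smooth_function_def
proof
  fix c assume c: "c \<in> \<A>"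
  let ?S = "snd c ` fst c" and ?q = "chart_inv c"
  have "smooth_on ?S (\<lambda>x. \<Sum>i\<in>Basis. (comp_in (V (?q x)) c \<bullet> i) * b (?q x) (coord_vector \<A> c (?q x) i))"
    by (intro smooth_on_sum smooth_on_mult chart_image_open[OF c] vector_field_smooth[OF V c]
        one_form_smooth[OF b c] finite_Basis)
  then show "smooth_on ?S (\<lambda>x. b (?q x) (V (?q x)))"
    by (rule smooth_on_cong[OF chart_image_open[OF c], rotated])
      (rule one_form_in_chart[OF b c, symmetric];
        simp add: chart_inv_in[OF c] vector_field_tangent[OF V])
qed

text \<open>The \<open>i\<close>-th component of this form in a chart is \<open>V\<^sup>j a\<^sub>j\<^sub>i\<close>.\<close>

lemma one_form_flat:
  assumes a: "riemannian_metric X \<A> a" and V: "vector_field X \<A> V"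
  shows "one_form X \<A> (\<lambda>p y. a p (V p) y)"
proof (rule one_formI)
  show "a p (V p) (u + v) = a p (V p) u + a p (V p) v"
    if "p \<in> topspace X" "u \<in> tangent_space \<A> p" "v \<in> tangent_space \<A> p" for p u v
    using metric_rules(2)[OF a that(1,2) vector_field_tangent[OF V that(1)] that(3)] .
  show "a p (V p) (r *\<^sub>R u) = r * a p (V p) u"
    if "p \<in> topspace X" "u \<in> tangent_space \<A> p" for p u r
    using metric_rules(4)[OF a that vector_field_tangent[OF V that(1)]] .
  fix c :: "('a, 'e) chart" and i :: 'e assume c: "c \<in> \<A>" and i: "i \<in> Basis"
  let ?S = "snd c ` fst c" and ?q = "chart_inv c"
  let ?d = "\<lambda>x. coord_vector \<A> c (?q x)"
  have "smooth_on ?S (\<lambda>x. \<Sum>j\<in>Basis. (comp_in (V (?q x)) c \<bullet> j) * a (?q x) (?d x j) (?d x i))"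
    by (intro smooth_on_sum smooth_on_mult chart_image_open[OF c] vector_field_smooth[OF V c]
        riemannian_metric_smooth[OF a c] finite_Basis i)
  then show "smooth_on ?S (\<lambda>x. a (?q x) (V (?q x)) (?d x i))"
  proof (rule smooth_on_cong[OF chart_image_open[OF c], rotated])
    fix x assume "x \<in> ?S"
    note q = chart_inv_in[OF c this]
    note T = coord_vector_tangent[OF M c q(1)] and L = coord_vector_linear[OF M c q(1)]
    note R = metric_rules[OF a q(2) T T]
    have l: "linear (\<lambda>u. a (?q x) (?d x u) (?d x i))"
      by (rule linearI) (simp_all add: linear_add[OF L] linear_scale[OF L] R(1)[OF T] R(3))
    have "a (?q x) (V (?q x)) (?d x i) =
        a (?q x) (?d x (\<Sum>j\<in>Basis. (comp_in (V (?q x)) c \<bullet> j) *\<^sub>R j)) (?d x i)"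
      by (simp add: euclidean_representation
          coord_vector_comp[OF M c q(1) vector_field_tangent[OF V q(2)]])
    then show "(\<Sum>j\<in>Basis. (comp_in (V (?q x)) c \<bullet> j) * a (?q x) (?d x j) (?d x i)) =
        a (?q x) (V (?q x)) (?d x i)"
      by (simp add: linear_sum[OF l] linear_scale[OF l])
  qed
qed

lemma riemannian_metric_conformal:
  assumes f: "smooth_function \<A> f" and pos: "\<And>p. p \<in> topspace X \<Longrightarrow> f p > 0"
    and a: "riemannian_metric X \<A> a"
  shows "riemannian_metric X \<A> (\<lambda>p u v. f p * a p u v)"
proof (rule riemannian_metricI)
  show "f p * a p (u + v) w = f p * a p u w + f p * a p v w"
    if "p \<in> topspace X" "u \<in> tangent_space \<A> p" "v \<in> tangent_space \<A> p" "w \<in> tangent_space \<A> p"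
    for p u v w
    using metric_rules(1)[OF a that(1,2,4,3)] by (simp add: algebra_simps)
  show "f p * a p (r *\<^sub>R u) w = r * (f p * a p u w)"
    if "p \<in> topspace X" "u \<in> tangent_space \<A> p" "w \<in> tangent_space \<A> p" for p u w r
    using metric_rules(3)[OF a that, of r] by simp
  show "f p * a p u v = f p * a p v u"
    if "p \<in> topspace X" "u \<in> tangent_space \<A> p" "v \<in> tangent_space \<A> p" for p u v
    using metric_rules(5)[OF a that] by simp
  show "f p * a p u u > 0" if "p \<in> topspace X" "u \<in> tangent_space \<A> p" "u \<noteq> 0" for p u
    using metric_rules(6)[OF a that(1,2,2,3)] pos[OF that(1)] by simp
next
  fix c :: "('a, 'e) chart" and i j :: 'e
  assume c: "c \<in> \<A>" and i: "i \<in> Basis" and j: "j \<in> Basis"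
  let ?q = "chart_inv c"
  have "smooth_on (snd c ` fst c) (\<lambda>x. f (?q x))"
    using f c unfolding smooth_function_def by blast
  then show "smooth_on (snd c ` fst c)
      (\<lambda>x. f (?q x) * a (?q x) (coord_vector \<A> c (?q x) i) (coord_vector \<A> c (?q x) j))"
    by (rule smooth_on_mult[OF chart_image_open[OF c] _ riemannian_metric_smooth[OF a c i j]])
qed

lemma riemannian_metric_add_square:
  assumes a: "riemannian_metric X \<A> a" and b: "one_form X \<A> b"
  shows "riemannian_metric X \<A> (\<lambda>p u v. a p u v + b p u * b p v)"
proof (rule riemannian_metricI)
  show "a p (u + v) w + b p (u + v) * b p w = (a p u w + b p u * b p w) + (a p v w + b p v * b p w)"
    if "p \<in> topspace X" "u \<in> tangent_space \<A> p" "v \<in> tangent_space \<A> p" "w \<in> tangent_space \<A> p"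
    for p u v w
    using metric_rules(1)[OF a that(1,2,4,3)] form_rules(1)[OF b that(1,2,3)]
    by (simp add: algebra_simps)
  show "a p (r *\<^sub>R u) w + b p (r *\<^sub>R u) * b p w = r * (a p u w + b p u * b p w)"
    if "p \<in> topspace X" "u \<in> tangent_space \<A> p" "w \<in> tangent_space \<A> p" for p u w r
    using metric_rules(3)[OF a that, of r] form_rules(2)[OF b that(1,2), of r]
    by (simp add: algebra_simps)
  show "a p u v + b p u * b p v = a p v u + b p v * b p u"
    if "p \<in> topspace X" "u \<in> tangent_space \<A> p" "v \<in> tangent_space \<A> p" for p u v
    using metric_rules(5)[OF a that] by simp
  show "a p u u + b p u * b p u > 0"
    if "p \<in> topspace X" "u \<in> tangent_space \<A> p" "u \<noteq> 0" for p u
    using metric_rules(6)[OF a that(1,2,2,3)] by (simp add: add_pos_nonneg)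
  fix c :: "('a, 'e) chart" and i j :: 'e
  assume c: "c \<in> \<A>" and i: "i \<in> Basis" and j: "j \<in> Basis"
  note S = chart_image_open[OF c]
  let ?q = "chart_inv c"
  let ?d = "\<lambda>x. coord_vector \<A> c (?q x)"
  show "smooth_on (snd c ` fst c)
      (\<lambda>x. a (?q x) (?d x i) (?d x j) + b (?q x) (?d x i) * b (?q x) (?d x j))"
    by (rule smooth_on_add[OF S riemannian_metric_smooth[OF a c i j]
          smooth_on_mult[OF S one_form_smooth[OF b c i] one_form_smooth[OF b c j]]])
qed

text \<open>If \<open>w\<close> represents \<open>b\<close> with respect to \<open>a + b \<otimes> b\<close>, then \<open>n = b(w)\<close> satisfies
  \<open>n = a(w,w) + n\<^sup>2\<close>, so \<open>n > n\<^sup>2\<close> unless \<open>w = 0\<close>.\<close>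

lemma form_norm_add_square:
  assumes a: "riemannian_metric X \<A> a" and b: "one_form X \<A> b" and p: "p \<in> topspace X"
  shows "form_norm \<A> (\<lambda>p u v. a p u v + b p u * b p v) b p < 1"
proof -
  define w where "w = sharp \<A> (\<lambda>p u v. a p u v + b p u * b p v) b p"
  have w: "w \<in> tangent_space \<A> p" "a p w w + b p w * b p w = b p w"
    using sharp_works[OF M riemannian_metric_add_square[OF a b] b p] unfolding w_def by auto
  have "b p w < 1"
  proof (cases "w = 0")
    case True
    then show ?thesis using form_rules(2)[OF b p w(1), of 0] by simp
  next
    case False
    have "a p w w > 0" using metric_rules(6)[OF a p w(1,1) False] .
    then have "b p w * b p w < b p w * 1" using w(2) by simp
    then show ?thesis
      by (metis less_eq_real_def linorder_not_less mult_less_cancel_left not_one_le_zero order_trans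
          zero_less_one)
  qed
  then show ?thesis unfolding form_norm_def w_def[symmetric] by simp
qed

end

section \<open>The quadratic equation of the navigation problem\<close>

text \<open>The coefficients \<open>\<theta>\<close> and \<open>\<lambda>\<close> of the quadratic equation that the navigation problem becomes.
  The latter equals \<open>(1 - F(-V)) \<beta>(-V)\<close>.\<close>

definition wind_form ::
  "('a \<Rightarrow> ('a, 'e) tvec \<Rightarrow> ('a, 'e) tvec \<Rightarrow> real) \<Rightarrow> ('a \<Rightarrow> ('a, 'e) tvec \<Rightarrow> real)
    \<Rightarrow> ('a \<Rightarrow> ('a, 'e) tvec) \<Rightarrow> 'a \<Rightarrow> ('a, 'e) tvec \<Rightarrow> real" where
  "wind_form a b V p y = 2 * a p (V p) y + b p y"

definition wind_defect ::
  "('a \<Rightarrow> ('a, 'e) tvec \<Rightarrow> ('a, 'e) tvec \<Rightarrow> real) \<Rightarrow> ('a \<Rightarrow> ('a, 'e) tvec \<Rightarrow> real)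
    \<Rightarrow> ('a \<Rightarrow> ('a, 'e) tvec) \<Rightarrow> 'a \<Rightarrow> real" where
  "wind_defect a b V p = - (a p (V p) (V p) + b p (V p))"

context
  fixes X :: "'a topology" and \<A> :: "('a, 'e::euclidean_space) chart set"
    and a :: "'a \<Rightarrow> ('a, 'e) tvec \<Rightarrow> ('a, 'e) tvec \<Rightarrow> real"
    and b F :: "'a \<Rightarrow> ('a, 'e) tvec \<Rightarrow> real"
    and A :: "'a \<Rightarrow> ('a, 'e) tvec set"
    and V :: "'a \<Rightarrow> ('a, 'e) tvec"
  assumes M: "smooth_manifold X \<A>"
    and F: "kropina_metric X \<A> a b F A"
    and V: "vector_field X \<A> V"
begin

lemma kropina_riemannian: "riemannian_metric X \<A> a" and kropina_one_form: "one_form X \<A> b"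
  using F unfolding kropina_metric_def by auto

lemma one_form_wind_form: "one_form X \<A> (wind_form a b V)"
proof -
  have "one_form X \<A> (\<lambda>p y. 2 * a p (V p) y + b p y)"
    by (rule one_form_add[OF M
          one_form_scale[OF M smooth_function_const one_form_flat[OF M kropina_riemannian V]]
          kropina_one_form])
  then show ?thesis by (simp add: wind_form_def[abs_def])
qed

lemma smooth_function_wind_defect: "smooth_function \<A> (wind_defect a b V)"
proof -
  have "smooth_function \<A> (\<lambda>p. (- 1) * (a p (V p) (V p) + b p (V p)))"
    by (rule smooth_function_mult[OF M smooth_function_const
          smooth_function_pairing[OF M
            one_form_add[OF M one_form_flat[OF M kropina_riemannian V] kropina_one_form] V]])
  then show ?thesis by (simp add: wind_defect_def[abs_def])
qed

lemma kropina_cone: "p \<in> topspace X \<Longrightarrow> A p = {y \<in> tangent_space \<A> p. b p y > 0}"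
  using F unfolding kropina_metric_def by blast

lemma metric_nonneg:
  assumes p: "p \<in> topspace X" and u: "u \<in> tangent_space \<A> p"
  shows "a p u u \<ge> 0"
proof (cases "u = 0")
  case True
  then show ?thesis using metric_rules(3)[OF M kropina_riemannian p u u, of 0] by simp
next
  case False
  then show ?thesis using metric_rules(6)[OF M kropina_riemannian p u u] by simp
qed

lemma kropina_value:
  assumes p: "p \<in> topspace X" and u: "u \<in> A p"
  shows "F p u = a p u u / b p u"
proof -
  have "F p u = (sqrt (a p u u))\<^sup>2 / b p u" using F p u unfolding kropina_metric_def by blast
  moreover have "a p u u \<ge> 0" using u kropina_cone[OF p] by (auto intro: metric_nonneg[OF p])
  ultimately show ?thesis by simp
qed

text \<open>Since \<open>\<beta>(-V) > 0\<close>, comparing \<open>F(-V)\<close> with 1 amounts to comparing \<open>a(V,V)\<close> with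
  \<open>-\<beta>(V)\<close>.\<close>

lemma wind_defect_sign:
  assumes p: "p \<in> topspace X" and "- V p \<in> A p"
  shows "b p (V p) < 0"
    and "F p (- V p) < 1 \<longleftrightarrow> wind_defect a b V p > 0"
    and "F p (- V p) = 1 \<longleftrightarrow> wind_defect a b V p = 0"
proof -
  note T = vector_field_tangent[OF V p]
  (* written as a multiple, so that homogeneity applies *)
  have mV: "- V p = (- 1) *\<^sub>R V p" by simp
  have b: "b p (- V p) = - b p (V p)"
    unfolding mV using form_rules(2)[OF M kropina_one_form p T]
    by (simp del: scaleR_minus_left scaleR_minus1_left)
  have T': "- V p \<in> tangent_space \<A> p" using assms kropina_cone by auto
  have a: "a p (- V p) (- V p) = a p (V p) (V p)"
    using metric_rules(3)[OF M kropina_riemannian p T T', of "- 1"]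
      metric_rules(4)[OF M kropina_riemannian p T T, of "- 1"]
    by simp
  show neg: "b p (V p) < 0" using assms kropina_cone b by auto
  have v: "F p (- V p) = a p (V p) (V p) / - b p (V p)"
    using kropina_value[OF assms] a b by simp
  show "F p (- V p) < 1 \<longleftrightarrow> wind_defect a b V p > 0"
    unfolding v wind_defect_def using neg by (subst pos_divide_less_eq) auto
  show "F p (- V p) = 1 \<longleftrightarrow> wind_defect a b V p = 0"
    unfolding v wind_defect_def using neg by (auto simp: field_simps)
qed

text \<open>The vector \<open>u = y/t - V\<close> lies on the quadric \<open>a(u,u) = \<beta>(u)\<close>. Substituting
  \<open>y = t (u + V)\<close> into \<open>a(y,y)\<close>, \<open>a(V,y)\<close> and \<open>\<beta>(y)\<close>, all terms containing \<open>u\<close> cancel but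
  \<open>t\<^sup>2 (a(u,u) - \<beta>(u)) = 0\<close>.\<close>

lemma navigation_quadratic:
  assumes p: "p \<in> topspace X" and y: "y \<in> tangent_space \<A> p" and n: "navigates F A V p y t"
  shows "wind_defect a b V p * t\<^sup>2 + wind_form a b V p y * t = a p y y"
proof -
  define u where "u = y /\<^sub>R t - V p"
  have t: "t > 0" and uA: "u \<in> A p" and "F p u = 1"
    using n unfolding navigates_def u_def by auto
  then have eq: "a p u u = b p u"
    using kropina_value[OF p uA] by (auto simp: divide_eq_1_iff)
  have u: "u \<in> tangent_space \<A> p" using uA kropina_cone[OF p] by auto
  note v = vector_field_tangent[OF V p]
  have S: "subspace (tangent_space \<A> p)" using tangent_subspace[OF M p] .
  have y_eq: "y = t *\<^sub>R (u + V p)" using t by (simp add: u_def)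
  have uv: "u + V p \<in> tangent_space \<A> p" using subspace_add[OF S u v] .
  note R = metric_rules[OF M kropina_riemannian p]
  have ayy: "a p y y = t\<^sup>2 * (a p u u + 2 * a p (V p) u + a p (V p) (V p))"
    using R(3)[OF uv y, of t] R(4)[OF uv uv, of t] R(1)[OF u uv v] R(2)[OF u u v] R(2)[OF u v v]
      R(5)[OF u v] unfolding y_eq[symmetric]
    by (simp add: power2_eq_square algebra_simps)
  have "a p (V p) y = t * (a p (V p) u + a p (V p) (V p))"
    using R(4)[OF uv v, of t] R(2)[OF u v v] unfolding y_eq[symmetric] by simp
  moreover have "b p y = t * (b p u + b p (V p))"
    using form_rules(2)[OF M kropina_one_form p uv, of t] form_rules(1)[OF M kropina_one_form p u v]
    unfolding y_eq[symmetric] by simp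
  ultimately show ?thesis
    unfolding ayy wind_form_def wind_defect_def eq
    by (simp add: power2_eq_square algebra_simps)
qed

text \<open>Two distinct positive roots \<open>s\<close>, \<open>t\<close> would have the product \<open>- a(y,y) / \<lambda> < 0\<close> if
  \<open>\<lambda> > 0\<close>, and a linear equation with nonzero right-hand side has one root at most.\<close>

lemma navigates_unique:
  assumes p: "p \<in> topspace X" and y: "y \<in> tangent_space \<A> p" "y \<noteq> 0"
    and ns: "navigates F A V p y s" and nt: "navigates F A V p y t"
    and defect: "wind_defect a b V p \<ge> 0"
  shows "s = t"
proof (rule ccontr)
  assume "s \<noteq> t"
  let ?l = "wind_defect a b V p" and ?m = "wind_form a b V p y"
  have pos: "s > 0" "t > 0" using ns nt unfolding navigates_def by auto
  note qs = navigation_quadratic[OF p y(1) ns] and qt = navigation_quadratic[OF p y(1) nt]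
  have "(s - t) * (?l * (s + t) + ?m) = 0"
    using qs qt by (simp add: power2_eq_square algebra_simps)
  then have "?m = - ?l * (s + t)" using \<open>s \<noteq> t\<close> by simp
  then have "a p y y = - (?l * (s * t))"
    unfolding qs[symmetric] by (simp only:) (simp add: power2_eq_square algebra_simps)
  also have "\<dots> \<le> 0" using defect pos by simp
  finally show False using metric_rules(6)[OF M kropina_riemannian p y(1,1,2)] by simp
qed

lemma navigation_solution_eq:
  assumes "p \<in> topspace X" "y \<in> tangent_space \<A> p" "y \<noteq> 0"
    and n: "navigates F A V p y t" and "wind_defect a b V p \<ge> 0"
  shows "navigation_solution F A V p y = t"
  unfolding navigation_solution_def
  using n by (rule the_equality) (use navigates_unique assms in blast)

end

text \<open>Completing the square; the positive sign of the square root is forced by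
  \<open>l * t + (l * t + m) > 0\<close>, as \<open>t * (l * t + m) = A \<ge> 0\<close>.\<close>

lemma positive_quadratic_root:
  fixes l m A t :: real
  assumes l: "l > 0" and t: "t > 0" and A: "A \<ge> 0" and eq: "l * t\<^sup>2 + m * t = A"
  defines "c \<equiv> - (1 / 2) * inverse l * m"
  shows "t = sqrt (inverse l * A + c * c) + c"
proof -
  have lc: "m = - 2 * l * c" using l by (simp add: c_def)
  have "t * (l * (t - 2 * c)) = A" using eq unfolding lc by (simp add: power2_eq_square algebra_simps)
  then have "t - 2 * c \<ge> 0" using A l t by (metis zero_le_mult_iff less_le_not_le)
  then have "t - c \<ge> 0" using t by simp
  moreover have "inverse l * A + c * c = (t - c)\<^sup>2"
    using eq l unfolding lc by (simp add: power2_eq_square field_simps)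
  ultimately show ?thesis by simp
qed

section \<open>Navigation by a Kropina metric\<close>

theorem theorem4p2:
  fixes X :: "'a topology" and \<A> :: "('a, 'e::euclidean_space) chart set"
    and a h :: "'a \<Rightarrow> ('a, 'e) tvec \<Rightarrow> ('a, 'e) tvec \<Rightarrow> real"
    and b F :: "'a \<Rightarrow> ('a, 'e) tvec \<Rightarrow> real"
    and A :: "'a \<Rightarrow> ('a, 'e) tvec set"
    and W V :: "'a \<Rightarrow> ('a, 'e) tvec"
  assumes M: "smooth_manifold X \<A>"
    and F: "kropina_metric X \<A> a b F A"
    and hW: "kropina_navigation_data X \<A> a b h W"
    and V: "vector_field X \<A> V"
    and V_cone: "\<forall>p\<in>topspace X. - V p \<in> A p"
    and V_le: "\<forall>p\<in>topspace X. F p (- V p) \<le> 1"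
  shows
    "(\<forall>p\<in>topspace X. \<forall>y\<in>navigation_domain \<A> F A V p. \<exists>!t. navigates F A V p y t) \<and>
     ((\<forall>p\<in>topspace X. F p (- V p) < 1) \<longrightarrow>
        (\<exists>a' b' F'. randers_metric X \<A> a' b' F' \<and>
          (\<forall>p\<in>topspace X. \<forall>y\<in>navigation_domain \<A> F A V p.
             navigation_solution F A V p y = F' p y))) \<and>
     ((\<forall>p\<in>topspace X. F p (- V p) = 1) \<longrightarrow>
        (\<exists>a' b' F' A'. kropina_metric X \<A> a' b' F' A' \<and>
          (\<forall>p\<in>topspace X. navigation_domain \<A> F A V p \<subseteq> A' p \<and>
             (\<forall>y\<in>navigation_domain \<A> F A V p.
                navigation_solution F A V p y = F' p y))))"
proof (intro conjI impI)
  note sign = wind_defect_sign[OF M F V _ bspec[OF V_cone]]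
  have defect: "wind_defect a b V p \<ge> 0" if "p \<in> topspace X" for p
    using sign(2,3)[OF that that] V_le that by (metis less_eq_real_def)
  note a = kropina_riemannian[OF M F V]
  have dom: "y \<in> tangent_space \<A> p" "y \<noteq> 0" "\<exists>t. navigates F A V p y t"
    if "y \<in> navigation_domain \<A> F A V p" for p y
    using that unfolding navigation_domain_def by auto

  show "\<forall>p\<in>topspace X. \<forall>y\<in>navigation_domain \<A> F A V p. \<exists>!t. navigates F A V p y t"
  proof (intro ballI)
    fix p y assume p: "p \<in> topspace X" and y: "y \<in> navigation_domain \<A> F A V p"
    show "\<exists>!t. navigates F A V p y t"
      using dom(3)[OF y] navigates_unique[OF M F V p dom(1,2)[OF y] _ _ defect[OF p]] by blast
  qed

  {
    assume "\<forall>p\<in>topspace X. F p (- V p) < 1"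
    then have pos: "wind_defect a b V p > 0" if "p \<in> topspace X" for p
      using sign(2)[OF that that] that by blast
    define f where "f p = inverse (wind_defect a b V p)" for p
    define b' where "b' p y = (- (1 / 2) * f p) * wind_form a b V p y" for p y
    define a' where "a' p u v = f p * a p u v + b' p u * b' p v" for p u v
    define F' where "F' p y = sqrt (a' p y y) + b' p y" for p y
    have f: "smooth_function \<A> f"
      unfolding f_def
      by (rule smooth_function_inverse[OF M smooth_function_wind_defect[OF M F V]]) (use pos in force)
    have fa: "riemannian_metric X \<A> (\<lambda>p u v. f p * a p u v)"
      by (rule riemannian_metric_conformal[OF M f _ a]) (simp add: f_def pos)
    have "one_form X \<A> (\<lambda>p y. (- (1 / 2) * f p) * wind_form a b V p y)"
      by (intro one_form_scale[OF M] smooth_function_mult[OF M] smooth_function_const f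
          one_form_wind_form[OF M F V])
    then have b': "one_form X \<A> b'" by (simp add: b'_def[abs_def])
    have "randers_metric X \<A> a' b' F'"
      using riemannian_metric_add_square[OF M fa b'] form_norm_add_square[OF M fa b'] b'
      unfolding randers_metric_def a'_def[abs_def] F'_def by blast
    moreover have "navigation_solution F A V p y = F' p y"
      if p: "p \<in> topspace X" and y: "y \<in> navigation_domain \<A> F A V p" for p y
    proof -
      obtain t where t: "navigates F A V p y t" using dom[OF y] by blast
      have "t = F' p y"
        unfolding F'_def a'_def b'_def f_def
        using t metric_nonneg[OF M F V p dom(1)[OF y]] navigation_quadratic[OF M F V p dom(1)[OF y] t]
        by (intro positive_quadratic_root pos[OF p]) (auto simp: navigates_def)
      then show ?thesis
        using navigation_solution_eq[OF M F V p dom(1,2)[OF y] t defect[OF p]] by simp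
    qed
    ultimately show "\<exists>a' b' F'. randers_metric X \<A> a' b' F' \<and>
        (\<forall>p\<in>topspace X. \<forall>y\<in>navigation_domain \<A> F A V p.
           navigation_solution F A V p y = F' p y)" by blast
  }

  {
    assume "\<forall>p\<in>topspace X. F p (- V p) = 1"
    then have zero: "wind_defect a b V p = 0" if "p \<in> topspace X" for p
      using sign(3)[OF that that] that by blast
    define b' where "b' = wind_form a b V"
    define A' where "A' p = {y \<in> tangent_space \<A> p. b' p y > 0}" for p
    define F' where "F' p y = (sqrt (a p y y))\<^sup>2 / b' p y" for p y
    have "b' p (V p) > 0" if p: "p \<in> topspace X" for p
      using zero[OF p] sign(1)[OF p p] by (simp add: b'_def wind_form_def wind_defect_def)
    then have "\<exists>y\<in>tangent_space \<A> p. b' p y \<noteq> 0" if "p \<in> topspace X" for p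
      using vector_field_tangent[OF V that] that by force
    then have "kropina_metric X \<A> a b' F' A'"
      using a one_form_wind_form[OF M F V] unfolding kropina_metric_def b'_def A'_def F'_def by simp
    moreover have "y \<in> A' p \<and> navigation_solution F A V p y = F' p y"
      if p: "p \<in> topspace X" and y: "y \<in> navigation_domain \<A> F A V p" for p y
    proof -
      obtain t where t: "navigates F A V p y t" using dom[OF y] by blast
      have eq: "b' p y * t = a p y y"
        using navigation_quadratic[OF M F V p dom(1)[OF y] t] zero[OF p] by (simp add: b'_def)
      have "t > 0" using t by (simp add: navigates_def)
      have apos: "a p y y > 0" using metric_rules(6)[OF M a p dom(1,1,2)[OF y]] .
      then have "b' p y > 0" using eq \<open>t > 0\<close> by (metis zero_less_mult_pos2)
      moreover from this have "t = F' p y"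
        using eq apos by (simp add: F'_def field_simps)
      ultimately show ?thesis
        using navigation_solution_eq[OF M F V p dom(1,2)[OF y] t defect[OF p]] dom(1)[OF y]
        by (simp add: A'_def)
    qed
    ultimately show "\<exists>a' b' F' A'. kropina_metric X \<A> a' b' F' A' \<and>
        (\<forall>p\<in>topspace X. navigation_domain \<A> F A V p \<subseteq> A' p \<and>
           (\<forall>y\<in>navigation_domain \<A> F A V p. navigation_solution F A V p y = F' p y))"
      by blast
  }
qed

end
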